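(* Let $t \geq 1$ and $\omega \geq 2$ be integers with $\frac{1}{2}(t+1) \leq \omega \leq t$. Then there exists a graph $G$ of treewidth $t$ and clique number $\omega$ satisfying \[\chi_f(G) \geq t + 1 - \sum_{i = 1}^{t - \omega + 1 } \frac{1}{\omega - i + 1}.\]
   Context: Graphs are finite and simple. The clique number of $G$ is the number of vertices in a largest clique of $G$. A $t$-tree is a graph obtained by starting with a $t$-clique and then iteratively adding vertices $v$ such that, at the time $v$ is added, its neighborhood $N(v)$ induces a $K_t$. A partial $t$-tree is a subgraph of a $t$-tree. The treewidth of $G$ is the minimum $t$ for which $G$ is a partial $t$-tree (this agrees with the usual definition of treewidth). A fractional coloring of $G$ assigns to each vertex $v \in V(G)$ a set $\phi(v) \subseteq \mathbb{R}$ of Lebesgue measure $\mu(\phi(v)) = 1$ so that $\phi(u) \cap \phi(v) = \emptyset$ for each edge $uv \in E(G)$. The fractional chromatic number $\chi_f(G)$ is the infimum of $\mu\left(\bigcup_{v \in V(G)} \phi(v)\right)$ over all fractional colorings $\phi$ of $G$. Equivalently, $\chi_f(G) = \inf_{b \geq 1} \chi_b(G)/b$, where $\chi_b(G)$ is the least $k$ such that one can assign to each vertex a $b$-element subset of $\{1,\dots,k\}$ with adjacent vertices receiving disjoint subsets. *)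

theory Defs
  imports "HOL-Analysis.Analysis" "Graph_Theory.Graph_Theory"
begin

text \<open>
  A finite simple graph is a \<^locale>\<open>pair_graph\<close>: a finite loop-free digraph whose arc relation
  is symmetric. An edge \<open>uv\<close> is the pair of arcs \<open>(u, v)\<close> and \<open>(v, u)\<close>.
\<close>

definition clique :: "'a pair_pre_digraph \<Rightarrow> 'a set \<Rightarrow> bool" where
  "clique G S \<longleftrightarrow> S \<subseteq> pverts G \<and> (\<forall>u\<in>S. \<forall>v\<in>S. u \<noteq> v \<longrightarrow> (u, v) \<in> parcs G)"

definition clique_number :: "'a pair_pre_digraph \<Rightarrow> nat" where
  "clique_number G = Max {card S | S. clique G S}"

inductive t_tree :: "nat \<Rightarrow> 'a pair_pre_digraph \<Rightarrow> bool" for t :: nat where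
  base: "complete_digraph t (with_proj G) \<Longrightarrow> t_tree t G"
| add_vertex: "t_tree t G \<Longrightarrow> v \<notin> pverts G \<Longrightarrow> clique G N \<Longrightarrow> card N = t \<Longrightarrow>
    t_tree t \<lparr>pverts = insert v (pverts G), parcs = parcs G \<union> {v} \<times> N \<union> N \<times> {v}\<rparr>"

text \<open>
  The relation \<^const>\<open>subgraph\<close> on digraphs does not force \<open>G\<close> to be symmetric, hence the
  separate requirement \<open>pair_graph G\<close>.
\<close>

definition partial_t_tree :: "nat \<Rightarrow> 'a pair_pre_digraph \<Rightarrow> bool" where
  "partial_t_tree t G \<longleftrightarrow>
     pair_graph G \<and> (\<exists>H. t_tree t H \<and> subgraph (with_proj G) (with_proj H))"

definition treewidth :: "'a pair_pre_digraph \<Rightarrow> nat" where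
  "treewidth G = (LEAST t. partial_t_tree t G)"

definition fractional_coloring :: "'a pair_pre_digraph \<Rightarrow> ('a \<Rightarrow> real set) \<Rightarrow> bool" where
  "fractional_coloring G \<phi> \<longleftrightarrow>
     (\<forall>v\<in>pverts G. \<phi> v \<in> sets lebesgue \<and> emeasure lebesgue (\<phi> v) = 1) \<and>
     (\<forall>(u, v)\<in>parcs G. \<phi> u \<inter> \<phi> v = {})"

text \<open>
  For a finite graph the union below has finite measure, so the real-valued \<^const>\<open>measure\<close>
  loses nothing.
\<close>

definition fractional_chromatic_number :: "'a pair_pre_digraph \<Rightarrow> real" where
  "fractional_chromatic_number G =
     Inf {measure lebesgue (\<Union>v\<in>pverts G. \<phi> v) | \<phi>. fractional_coloring G \<phi>}"

text \<open>
  The maximum, the least number and the infimum above are taken over suitable sets: finite and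
  nonempty, nonempty, and nonempty and bounded below, respectively.
\<close>

lemma finite_clique_cards:
  assumes "pair_graph G"
  shows "finite {card S | S. clique G S}" and "{card S | S. clique G S} \<noteq> {}"
proof -
  interpret pair_graph G by fact
  have "{card S | S. clique G S} \<subseteq> card ` Pow (pverts G)"
    by (auto simp: clique_def)
  then show "finite {card S | S. clique G S}"
    by (rule finite_subset) (simp add: pair_finite_verts)
  have "clique G {}"
    by (simp add: clique_def)
  then show "{card S | S. clique G S} \<noteq> {}"
    by blast
qed

lemma partial_t_tree_card:
  assumes "pair_graph G"
  shows "partial_t_tree (card (pverts G)) G"
proof -
  interpret pair_graph G by fact
  define H where
    "H = \<lparr>pverts = pverts G, parcs = {(u, v). (u, v) \<in> pverts G \<times> pverts G \<and> u \<noteq> v}\<rparr>"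
  have K: "complete_digraph (card (pverts G)) (with_proj H)"
    unfolding complete_digraph_pair_def by (simp add: H_def pair_finite_verts)
  interpret H: pair_graph H
    using K by (rule pair_graphI_complete)
  have "parcs G \<subseteq> parcs H"
    using pair_no_loops arc_fst_in_verts arc_snd_in_verts by (fastforce simp: H_def)
  then have "subgraph (with_proj G) (with_proj H)"
    unfolding subgraph_def using wf_digraph H.wf_digraph
    by (auto simp: H_def)
  with K assms show ?thesis
    unfolding partial_t_tree_def by (blast intro: t_tree.base)
qed

lemma fractional_coloring_exists:
  assumes "pair_graph G"
  shows "\<exists>\<phi>. fractional_coloring G \<phi>"
proof -
  interpret pair_graph G by fact
  obtain f :: "'a \<Rightarrow> nat" where f: "inj_on f (pverts G)"
    using pair_finite_verts finite_imp_inj_to_nat_seg by blast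
  have "{real (f u)..<real (f u) + 1} \<inter> {real (f v)..<real (f v) + 1} = {}"
    if "(u, v) \<in> parcs G" for u v
  proof -
    have "f u \<noteq> f v"
      using that f pair_no_loops[OF that] in_arcsD1[OF that] in_arcsD2[OF that]
      by (auto dest: inj_onD)
    then show ?thesis by auto
  qed
  then have "fractional_coloring G (\<lambda>v. {real (f v)..<real (f v) + 1})"
    by (auto simp: fractional_coloring_def)
  then show ?thesis by blast
qed

lemma bdd_below_fractional_colorings:
  "bdd_below {measure lebesgue (\<Union>v\<in>pverts G. \<phi> v) | \<phi>. fractional_coloring G \<phi>}"
  by (rule bdd_belowI[of _ 0]) auto

end

theory Submission
  imports Defs "HOL-Library.Infinite_Typeclass"
begin

text \<open>
  Let \<open>k = t + 1 - \<omega>\<close>. Some bag of a \<open>t\<close>-tree is forced to consist of \<open>k\<close> nonadjacent pairs and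
  a clique on \<open>t + 1 - 2k\<close> further vertices, all else being adjacent, with small color overlap in
  each pair. Given \<open>j < k\<close> pairs, join to them a clique \<open>U\<close> of size \<open>\<omega> - j\<close> and a further vertex
  \<open>a\<close> that has no neighbor in \<open>U\<close>. The color sets of \<open>U\<close> are disjoint and that of \<open>a\<close> has measure
  \<open>1\<close>, so it meets the color set of some \<open>u \<in> U\<close> in measure at most \<open>1 / (\<omega> - j)\<close>, and \<open>{a, u}\<close> is
  the next pair. Which \<open>u\<close> works depends on the coloring; the graph therefore contains a
  continuation for each of the finitely many choices.
\<close>

section \<open>Induced extensions and vertex attachment\<close>

text \<open>The induced subgraph relation. Nonadjacency of old vertices must survive all later
  attachments, and with it both the clique bounds inside an old vertex set and the degrees counted
  there.\<close>

definition extends :: "'a pair_pre_digraph \<Rightarrow> 'a pair_pre_digraph \<Rightarrow> bool" where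
  "extends G G' \<longleftrightarrow> pverts G \<subseteq> pverts G' \<and> parcs G = parcs G' \<inter> pverts G \<times> pverts G"

lemma extends_refl: "pair_graph G \<Longrightarrow> extends G G"
proof -
  assume "pair_graph G"
  then interpret pair_graph G .
  show ?thesis by (auto simp: extends_def dest: in_arcsD1 in_arcsD2)
qed

lemma extends_trans: "extends G G' \<Longrightarrow> extends G' G'' \<Longrightarrow> extends G G''"
  unfolding extends_def by blast

lemma extends_pverts: "extends G G' \<Longrightarrow> pverts G \<subseteq> pverts G'"
  and extends_parcs: "extends G G' \<Longrightarrow> parcs G \<subseteq> parcs G'"
  unfolding extends_def by auto

lemma clique_subset: "clique G S \<Longrightarrow> R \<subseteq> S \<Longrightarrow> clique G R"
  by (auto simp: clique_def)

lemma clique_extends: "extends G G' \<Longrightarrow> clique G S \<Longrightarrow> clique G' S"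
  by (auto simp: extends_def clique_def)

lemma clique_extendsD: "extends G G' \<Longrightarrow> clique G' S \<Longrightarrow> S \<subseteq> pverts G \<Longrightarrow> clique G S"
  by (auto simp: extends_def clique_def)

text \<open>\<open>N\<close> is left arbitrary because the same operation serves the
  \<open>t\<close>-tree, where \<open>N\<close> is a \<open>t\<close>-clique, and the graph inside
  it, where \<open>v\<close> receives fewer neighbors.\<close>

definition attach :: "'a pair_pre_digraph \<Rightarrow> 'a \<Rightarrow> 'a set \<Rightarrow> 'a pair_pre_digraph" where
  "attach G v N = \<lparr>pverts = insert v (pverts G), parcs = parcs G \<union> {v} \<times> N \<union> N \<times> {v}\<rparr>"

lemma attach_simps [simp]:
  "pverts (attach G v N) = insert v (pverts G)"
  "parcs (attach G v N) = parcs G \<union> {v} \<times> N \<union> N \<times> {v}"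
  by (simp_all add: attach_def)

lemma pair_graph_attach:
  assumes "pair_graph G" "v \<notin> pverts G" "N \<subseteq> pverts G"
  shows "pair_graph (attach G v N)"
proof -
  interpret pair_graph G by fact
  have N: "finite N" using assms(3) pair_finite_verts finite_subset by blast
  have "symmetric (with_proj (attach G v N))"
    unfolding symmetric_def by (auto intro!: symI dest: arcs_symmetric)
  then show ?thesis
    using assms(2,3) N pair_finite_verts pair_finite_arcs pair_no_loops
    by unfold_locales (auto dest: in_arcsD1 in_arcsD2)
qed

lemma extends_attach:
  assumes "pair_graph G" "v \<notin> pverts G"
  shows "extends G (attach G v N)"
proof -
  interpret pair_graph G by fact
  show ?thesis using assms(2) by (auto simp: extends_def dest: in_arcsD1 in_arcsD2)
qed

section \<open>Cliques and degeneracy of \<open>t\<close>-trees\<close>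

lemma t_tree_attach:
  "t_tree t G \<Longrightarrow> v \<notin> pverts G \<Longrightarrow> clique G N \<Longrightarrow> card N = t \<Longrightarrow> t_tree t (attach G v N)"
  unfolding attach_def by (rule t_tree.add_vertex)

lemma t_tree_induct [consumes 1, case_names base attach]:
  assumes "t_tree t H"
    and "\<And>H. complete_digraph t (with_proj H) \<Longrightarrow> P H"
    and "\<And>H v N. t_tree t H \<Longrightarrow> P H \<Longrightarrow> v \<notin> pverts H \<Longrightarrow> clique H N \<Longrightarrow> card N = t \<Longrightarrow>
      P (attach H v N)"
  shows "P H"
  using assms(1) by induction (auto simp: attach_def[symmetric] intro: assms(2,3))

lemma t_tree_pair_graph: "t_tree t H \<Longrightarrow> pair_graph H"
proof (induction rule: t_tree_induct)
  case (attach H v N)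
  then show ?case by (auto simp: clique_def intro: pair_graph_attach)
qed (rule pair_graphI_complete)

text \<open>This allows attaching a vertex over any clique of size at most \<open>t\<close>, by
  padding it to a full \<open>t\<close>-clique. A clique through the newest vertex \<open>v\<close>
  has all its other vertices in the neighborhood \<open>N\<close> of \<open>v\<close>.\<close>

lemma t_tree_clique_extension:
  "t_tree t H \<Longrightarrow> clique H X \<Longrightarrow> card X \<le> t \<Longrightarrow> \<exists>N. X \<subseteq> N \<and> clique H N \<and> card N = t"
proof (induction arbitrary: X rule: t_tree_induct)
  case (base H)
  then show ?case
    by (intro exI[of _ "pverts H"]) (auto simp: complete_digraph_pair_def clique_def)
next
  case (attach H v N)
  have ext: "extends H (attach H v N)"
    by (intro extends_attach t_tree_pair_graph[of t] attach.hyps)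
  interpret pair_graph H using attach.hyps(1) by (rule t_tree_pair_graph)
  show ?case
  proof (cases "v \<in> X")
    case False
    then have "X \<subseteq> pverts H" using attach.prems by (auto simp: clique_def)
    then have "clique H X" using attach.prems(1) by (intro clique_extendsD[OF ext])
    then obtain N where "X \<subseteq> N" "clique H N" "card N = t"
      using attach.IH attach.prems(2) by metis
    then show ?thesis using clique_extends[OF ext] by metis
  next
    case True
    have N: "finite N" "v \<notin> N"
      using attach.hyps pair_finite_verts by (auto simp: clique_def intro: finite_subset)
    have XN: "X - {v} \<subseteq> N"
    proof
      fix x assume "x \<in> X - {v}"
      then have "(v, x) \<in> parcs (attach H v N)"
        using attach.prems True by (auto simp: clique_def)
      then show "x \<in> N" using attach.hyps by (auto dest: in_arcsD1)
    qed
    then have "finite (X - {v})" using N(1) by (rule finite_subset)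
    then have "card (X - {v}) \<le> t - 1" "t \<ge> 1"
      using True attach.prems(2) card_Suc_Diff1[of X v] by auto
    \<comment> \<open>The padded clique is \<open>N\<close> with one vertex outside \<open>X\<close>
      exchanged for \<open>v\<close>.\<close>
    then obtain R where R: "X - {v} \<subseteq> R" "R \<subseteq> N" "card R = t - 1"
      using exists_subset_between[of "X - {v}" "t - 1" N] XN N(1) attach.hyps(4) by auto
    have "finite R" "v \<notin> R" using R(2) N by (auto intro: finite_subset)
    then have "card (insert v R) = t" using R(3) \<open>t \<ge> 1\<close> by simp
    moreover have "clique (attach H v N) (insert v R)"
      using attach.hyps R(2) unfolding clique_def by auto
    ultimately show ?thesis using R(1) by blast
  qed
qed

text \<open>Degeneracy: the member of \<open>W\<close> attached last sees at most its
  \<open>s\<close> attachment neighbors in \<open>W\<close>; if all of \<open>W\<close> lies in the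
  initial clique, then \<open>W\<close> itself has at most \<open>s\<close> vertices.\<close>

lemma t_tree_low_degree:
  "t_tree s H \<Longrightarrow> W \<subseteq> pverts H \<Longrightarrow> W \<noteq> {} \<Longrightarrow> \<exists>w\<in>W. card {x\<in>W. (w, x) \<in> parcs H} \<le> s"
proof (induction arbitrary: W rule: t_tree_induct)
  case (base H)
  then interpret pair_graph H by (intro pair_graphI_complete)
  obtain w where "w \<in> W" using base by blast
  moreover have "card {x\<in>W. (w, x) \<in> parcs H} \<le> card (pverts H)"
    using base pair_finite_verts by (intro card_mono) auto
  ultimately show ?case using base by (auto simp: complete_digraph_pair_def)
next
  case (attach H v N)
  interpret pair_graph H using attach.hyps(1) by (rule t_tree_pair_graph)
  show ?case
  proof (cases "v \<in> W")
    case True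
    have "finite N"
      using attach.hyps pair_finite_verts by (auto simp: clique_def intro: finite_subset)
    moreover have "{x\<in>W. (v, x) \<in> parcs (attach H v N)} \<subseteq> N"
      using attach.hyps by (auto dest: in_arcsD1)
    ultimately have "card {x\<in>W. (v, x) \<in> parcs (attach H v N)} \<le> s"
      using attach.hyps card_mono by blast
    with True show ?thesis by blast
  next
    case False
    then have "W \<subseteq> pverts H" using attach.prems by auto
    then obtain w where w: "w \<in> W" "card {x\<in>W. (w, x) \<in> parcs H} \<le> s"
      using attach.IH attach.prems by blast
    have "{x\<in>W. (w, x) \<in> parcs (attach H v N)} = {x\<in>W. (w, x) \<in> parcs H}"
      using w False by auto
    then show ?thesis using w by (intro bexI[of _ w]) simp_all
  qed
qed

text \<open>The lower bound on treewidth. Passing to the surrounding \<open>s\<close>-tree only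
  raises degrees within \<open>W\<close>, so degeneracy applies there.\<close>

lemma partial_t_tree_min_degree:
  assumes "partial_t_tree s G" "W \<subseteq> pverts G" "W \<noteq> {}"
    and "\<And>w. w \<in> W \<Longrightarrow> t \<le> card {x\<in>W. (w, x) \<in> parcs G}"
  shows "t \<le> s"
proof -
  obtain H where H: "t_tree s H" "subgraph (with_proj G) (with_proj H)" and "pair_graph G"
    using assms(1) by (auto simp: partial_t_tree_def)
  interpret pair_graph G by fact
  have sub: "pverts G \<subseteq> pverts H" "parcs G \<subseteq> parcs H"
    using H(2) by (auto simp: subgraph_def)
  obtain w where w: "w \<in> W" "card {x\<in>W. (w, x) \<in> parcs H} \<le> s"
    using t_tree_low_degree[OF H(1)] assms(2,3) sub by blast
  have "t \<le> card {x\<in>W. (w, x) \<in> parcs G}" by (rule assms(4)) fact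
  also have "\<dots> \<le> card {x\<in>W. (w, x) \<in> parcs H}"
    using sub assms(2) pair_finite_verts by (intro card_mono) (auto intro: finite_subset)
  finally show ?thesis using w by simp
qed

section \<open>Growing a graph inside a \<open>t\<close>-tree\<close>

text \<open>
  A graph under construction, together with a \<open>t\<close>-tree on the same vertices that witnesses its
  treewidth.
\<close>

definition scaffold :: "nat \<Rightarrow> nat \<Rightarrow> 'a pair_pre_digraph \<Rightarrow> 'a pair_pre_digraph \<Rightarrow> bool" where
  "scaffold t \<omega> H G \<longleftrightarrow> t_tree t H \<and> pair_graph G \<and> pverts G = pverts H \<and> parcs G \<subseteq> parcs H \<and>
     (\<forall>S. clique G S \<longrightarrow> card S \<le> \<omega>)"

lemma scaffold_pair_graph:
  "scaffold t \<omega> H G \<Longrightarrow> pair_graph G" "scaffold t \<omega> H G \<Longrightarrow> pair_graph H"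
  by (auto simp: scaffold_def intro: t_tree_pair_graph)

lemma scaffold_partial_t_tree: "scaffold t \<omega> H G \<Longrightarrow> partial_t_tree t G"
proof -
  assume s: "scaffold t \<omega> H G"
  interpret G: pair_graph G using s by (rule scaffold_pair_graph)
  interpret H: pair_graph H using s by (rule scaffold_pair_graph)
  have "subgraph (with_proj G) (with_proj H)"
    using s G.wf_digraph H.wf_digraph by (auto simp: subgraph_def scaffold_def)
  then show ?thesis using s by (auto simp: partial_t_tree_def scaffold_def)
qed

lemma scaffold_finite_clique:
  assumes "scaffold t \<omega> H G" "clique H X"
  shows "finite X"
proof -
  interpret pair_graph H using assms(1) by (rule scaffold_pair_graph)
  show ?thesis using assms(2) pair_finite_verts by (auto simp: clique_def intro: finite_subset)
qed

text \<open>The \<open>t\<close>-tree joins \<open>v\<close> to a \<open>t\<close>-clique containing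
  \<open>X\<close>, the graph only to \<open>M\<close>. So \<open>insert v X\<close> remains usable
  as a bag although \<open>v\<close> may have nonneighbors in it. A new clique is \<open>v\<close>
  plus a clique inside \<open>M\<close>, which \<open>cl\<close> keeps below
  \<open>\<omega>\<close>.\<close>

lemma scaffold_add_vertex:
  fixes G H :: "'a::infinite pair_pre_digraph"
  assumes s: "scaffold t \<omega> H G" and X: "clique H X" "card X \<le> t" and M: "M \<subseteq> X"
    and cl: "\<And>S. S \<subseteq> M \<Longrightarrow> clique G S \<Longrightarrow> card S < \<omega>"
  obtains v H' G' where "scaffold t \<omega> H' G'" "extends H H'" "extends G G'" "v \<notin> pverts G"
    "clique H' (insert v X)" "\<And>w. (v, w) \<in> parcs G' \<longleftrightarrow> w \<in> M" "v \<in> pverts G'"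
proof -
  interpret G: pair_graph G using s by (rule scaffold_pair_graph)
  interpret H: pair_graph H using s by (rule scaffold_pair_graph)
  obtain N where N: "X \<subseteq> N" "clique H N" "card N = t"
    using t_tree_clique_extension[OF _ X] s unfolding scaffold_def by metis
  obtain v where v: "v \<notin> pverts G"
    using ex_new_if_finite[OF infinite_UNIV G.pair_finite_verts] by auto
  then have v': "v \<notin> pverts H" using s by (simp add: scaffold_def)
  let ?H = "attach H v N" and ?G = "attach G v M"
  have MG: "M \<subseteq> pverts G" using M X s by (auto simp: scaffold_def clique_def)
  have eG: "extends G ?G" and eH: "extends H ?H"
    using v v' G.pair_graph H.pair_graph by (auto intro: extends_attach)
  have "card S \<le> \<omega>" if S: "clique ?G S" for S
  proof (cases "v \<in> S")
    case False
    then have "clique G S" using S by (intro clique_extendsD[OF eG]) (auto simp: clique_def)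
    then show ?thesis using s by (simp add: scaffold_def)
  next
    case True
    have "S - {v} \<subseteq> M"
    proof
      fix x assume "x \<in> S - {v}"
      then have "(v, x) \<in> parcs ?G"
        using S True by (auto simp: clique_def)
      then show "x \<in> M" using v by (auto dest: G.in_arcsD1)
    qed
    moreover from this have "clique G (S - {v})"
      using S MG by (intro clique_extendsD[OF eG]) (auto intro: clique_subset)
    \<comment> \<open>For infinite \<open>S\<close> the bound holds because \<open>card S\<close> is
      0.\<close>
    ultimately show ?thesis using cl[of "S - {v}"] True
      by (cases "finite S") auto
  qed
  then have "scaffold t \<omega> ?H ?G"
    using s v v' N M MG G.pair_graph
    by (auto simp: scaffold_def intro!: t_tree_attach pair_graph_attach)
  moreover have "clique ?H (insert v X)"
    using N by (auto simp: clique_def)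
  moreover have "(v, w) \<in> parcs ?G \<longleftrightarrow> w \<in> M" for w
    using v MG by (auto dest: G.in_arcsD1)
  ultimately show ?thesis using that v eG eH by auto
qed

text \<open>The vertices of \<open>U\<close> are added singly, each joined to \<open>B\<close> and
  to its predecessors. The last one is attached over a clique of \<open>card B + n - 1\<close>
  vertices, which must not exceed \<open>t\<close>; the clique bound holds because a clique inside
  \<open>B\<close> leaves room for all \<open>n\<close> new vertices.\<close>

lemma scaffold_add_clique:
  fixes G H :: "'a::infinite pair_pre_digraph"
  assumes s: "scaffold t \<omega> H G" and B: "clique H B" and size: "card B + n \<le> t + 1"
    and cl: "\<And>S. S \<subseteq> B \<Longrightarrow> clique G S \<Longrightarrow> card S + n \<le> \<omega>"
  obtains U H' G' where "scaffold t \<omega> H' G'" "extends H H'" "extends G G'" "finite U" "card U = n"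
    "U \<inter> pverts G = {}" "clique G' U" "U \<times> B \<subseteq> parcs G'" "clique H' (B \<union> U)"
  using size cl
proof (induction n arbitrary: thesis)
  case 0
  show ?case
    using s B by (intro "0.prems"(1)[of H G "{}"]) (auto intro: extends_refl scaffold_pair_graph simp: clique_def)
next
  case (Suc n)
  have size: "card B + n \<le> t + 1" using Suc.prems(2) by simp
  have cl: "card S + n \<le> \<omega>" if "S \<subseteq> B" "clique G S" for S
    using Suc.prems(3)[OF that] by simp
  obtain U H1 G1 where 1: "scaffold t \<omega> H1 G1" "extends H H1" "extends G G1" "finite U" "card U = n"
    "U \<inter> pverts G = {}" "clique G1 U" "U \<times> B \<subseteq> parcs G1" "clique H1 (B \<union> U)"
    by (rule Suc.IH[OF _ size cl])
  have BG: "B \<subseteq> pverts G" "finite B"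
    using B s scaffold_finite_clique[OF s B] by (auto simp: clique_def scaffold_def)
  have "card (B \<union> U) \<le> t" using card_Un_le[of B U] 1 Suc.prems(2) by simp
  moreover have "card S < \<omega>" if S: "S \<subseteq> B \<union> U" "clique G1 S" for S
  proof -
    have "clique G (S \<inter> B)"
      using S BG by (intro clique_extendsD[OF 1(3)]) (auto intro: clique_subset)
    then have "card (S \<inter> B) + Suc n \<le> \<omega>" using Suc.prems(3) by blast
    moreover have "card S \<le> card ((S \<inter> B) \<union> U)"
      using S BG 1 by (intro card_mono) auto
    ultimately show ?thesis using card_Un_le[of "S \<inter> B" U] 1 by simp
  qed
  ultimately obtain v H2 G2 where 2: "scaffold t \<omega> H2 G2" "extends H1 H2" "extends G1 G2"
    "v \<notin> pverts G1" "clique H2 (insert v (B \<union> U))" "\<And>w. (v, w) \<in> parcs G2 \<longleftrightarrow> w \<in> B \<union> U"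
    "v \<in> pverts G2"
    using scaffold_add_vertex[OF 1(1,9) _ order_refl] by metis
  interpret G2: pair_graph G2 using 2(1) by (rule scaffold_pair_graph)
  have vU: "v \<notin> U" using 1(7) 2(4) by (auto simp: clique_def)
  have "clique G2 U" using clique_extends[OF 2(3) 1(7)] .
  then have "clique G2 (insert v U)"
    using 2(6,7) G2.arcs_symmetric unfolding clique_def by blast
  moreover have "insert v U \<times> B \<subseteq> parcs G2"
    using 1(8) 2(6) extends_parcs[OF 2(3)] by blast
  moreover have "insert v U \<inter> pverts G = {}"
    using 1(6) 2(4) extends_pverts[OF 1(3)] by blast
  ultimately show ?case
    using 1 2 vU by (intro Suc.prems(1)[of H2 G2 "insert v U"]) (auto intro: extends_trans)
qed

text \<open>The continuations are built one after another in a single growing graph. Hence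
  \<open>step\<close> must work from every extension of the start, and \<open>mono\<close> must
  preserve what was achieved for earlier elements.\<close>

lemma scaffold_extend_all:
  assumes "finite U" and s: "scaffold t \<omega> H G"
    and step: "\<And>u H' G'. \<lbrakk>u \<in> U; scaffold t \<omega> H' G'; extends H H'; extends G G'\<rbrakk> \<Longrightarrow>
      \<exists>H'' G''. scaffold t \<omega> H'' G'' \<and> extends H' H'' \<and> extends G' G'' \<and> Q u G''"
    and mono: "\<And>u G' G''. \<lbrakk>Q u G'; extends G' G''; pair_graph G''\<rbrakk> \<Longrightarrow> Q u G''"
  shows "\<exists>H' G'. scaffold t \<omega> H' G' \<and> extends H H' \<and> extends G G' \<and> (\<forall>u\<in>U. Q u G')"
  using assms(1) step
proof (induction U)
  case empty
  show ?case using s by (auto intro: extends_refl scaffold_pair_graph)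
next
  case (insert u U)
  have "\<exists>H' G'. scaffold t \<omega> H' G' \<and> extends H H' \<and> extends G G' \<and> (\<forall>u\<in>U. Q u G')"
    by (rule insert.IH) (use insert.prems in blast)
  then obtain H1 G1 where 1: "scaffold t \<omega> H1 G1" "extends H H1" "extends G G1" "\<forall>u\<in>U. Q u G1"
    by blast
  obtain H2 G2 where 2: "scaffold t \<omega> H2 G2" "extends H1 H2" "extends G1 G2" "Q u G2"
    using insert.prems[of u H1 G1] 1 by blast
  show ?case
    using 1 2 mono extends_trans scaffold_pair_graph(1) by (metis insert_iff)
qed

section \<open>Measures of color sets\<close>

lemma fractional_coloring_extends:
  "extends G G' \<Longrightarrow> fractional_coloring G' \<phi> \<Longrightarrow> fractional_coloring G \<phi>"
  unfolding extends_def fractional_coloring_def by blast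

lemma fractional_coloring_lmeasurable:
  assumes "fractional_coloring G \<phi>" "v \<in> pverts G"
  shows "\<phi> v \<in> lmeasurable" "measure lebesgue (\<phi> v) = 1"
  using assms by (auto simp: fractional_coloring_def fmeasurable_def measure_def)

lemma fractional_coloring_UN_lmeasurable:
  assumes "fractional_coloring G \<phi>" "finite B" "B \<subseteq> pverts G"
  shows "(\<Union>v\<in>B. \<phi> v) \<in> lmeasurable"
  using assms fractional_coloring_lmeasurable(1)[OF assms(1)] by (intro fmeasurable.finite_UN) auto

lemma fractional_coloring_disjoint:
  "fractional_coloring G \<phi> \<Longrightarrow> U \<times> B \<subseteq> parcs G \<Longrightarrow> (\<Union>u\<in>U. \<phi> u) \<inter> (\<Union>v\<in>B. \<phi> v) = {}"
  unfolding fractional_coloring_def by blast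

lemma fractional_coloring_clique:
  assumes "fractional_coloring G \<phi>" "clique G U" "finite U"
  shows "measure lebesgue (\<Union>u\<in>U. \<phi> u) = card U"
proof -
  have "disjoint_family_on \<phi> U"
    using assms unfolding disjoint_family_on_def clique_def fractional_coloring_def by blast
  then have "measure lebesgue (\<Union>u\<in>U. \<phi> u) = (\<Sum>u\<in>U. measure lebesgue (\<phi> u))"
    using assms(2) fractional_coloring_lmeasurable(1)[OF assms(1)]
    by (intro measure_UNION'[OF \<open>finite U\<close>]) (auto simp: clique_def disjoint_family_on_def pairwise_def disjnt_def)
  also have "\<dots> = card U"
    using assms(2) fractional_coloring_lmeasurable(2)[OF assms(1)]
    by (auto simp: clique_def subset_iff)
  finally show ?thesis .
qed

lemma measure_lebesgue_Un_disjoint: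
  assumes "A \<in> lmeasurable" "B \<in> lmeasurable" "A \<inter> B = {}"
  shows "measure lebesgue (A \<union> B) = measure lebesgue A + measure lebesgue B"
  using measure_Un3[OF assms(1,2)] assms(3) by simp

text \<open>Averaging: the overlaps with the members of \<open>U\<close> are \<open>card U\<close>
  disjoint pieces of \<open>\<phi> a\<close>, a set of measure 1.\<close>

lemma fractional_coloring_small_overlap:
  assumes \<phi>: "fractional_coloring G \<phi>" and U: "clique G U" "finite U" "U \<noteq> {}" and a: "a \<in> pverts G"
  shows "\<exists>u\<in>U. measure lebesgue (\<phi> a \<inter> \<phi> u) \<le> 1 / card U"
proof -
  note meas = fractional_coloring_lmeasurable[OF \<phi>]
  have UG: "U \<subseteq> pverts G" using U by (simp add: clique_def)
  have disj: "pairwise (\<lambda>u w. disjnt (\<phi> a \<inter> \<phi> u) (\<phi> a \<inter> \<phi> w)) U"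
    using U \<phi> unfolding pairwise_def disjnt_def clique_def fractional_coloring_def by blast
  have mI: "\<phi> a \<inter> \<phi> u \<in> lmeasurable" if "u \<in> U" for u
    using that UG meas(1) a by (intro fmeasurable_Int_fmeasurable) auto
  have "(\<Sum>u\<in>U. measure lebesgue (\<phi> a \<inter> \<phi> u)) = measure lebesgue (\<Union>u\<in>U. \<phi> a \<inter> \<phi> u)"
    using mI disj by (intro measure_UNION'[OF U(2), symmetric]) (auto simp: pairwise_def)
  also have "\<dots> \<le> measure lebesgue (\<phi> a)"
    using fmeasurable.finite_UN[OF U(2) mI] meas(1)[OF a] by (intro measure_mono_fmeasurable) auto
  also have "\<dots> = 1" using meas(2) a by blast
  finally have sum: "(\<Sum>u\<in>U. measure lebesgue (\<phi> a \<inter> \<phi> u)) \<le> 1" .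
  show ?thesis
  proof (rule ccontr)
    assume "\<not> ?thesis"
    then have "1 / card U < measure lebesgue (\<phi> a \<inter> \<phi> u)" if "u \<in> U" for u
      using that by force
    then have "(\<Sum>u\<in>U. 1 / real (card U)) < (\<Sum>u\<in>U. measure lebesgue (\<phi> a \<inter> \<phi> u))"
      using U by (intro sum_strict_mono) auto
    with sum show False using U by simp
  qed
qed

section \<open>Forcing many colors on a bag\<close>

text \<open>Downward induction from \<open>k\<close> to \<open>j\<close>. A further pair contributes
  at least \<open>2 - 1 / (\<omega> - j)\<close> new colors, which turns the bound for
  \<open>j\<close> into the one for \<open>Suc j\<close>. Since \<open>G'\<close> must be fixed
  before the coloring is known, the bound on \<open>B\<close> is a premise on each
  \<open>\<phi>\<close>, not an assumption of the lemma.\<close>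

lemma scaffold_forces_colors:
  fixes G H :: "'a::infinite pair_pre_digraph" and \<omega> k t :: nat and S :: "nat \<Rightarrow> real"
  defines "S \<equiv> \<lambda>j. \<Sum>i = 1..j. 1 / (real \<omega> - real i + 1)"
  assumes t: "t + 1 = \<omega> + k" and k: "k \<le> \<omega>" and "j \<le> k"
    and "scaffold t \<omega> H G" "clique H B" "card B = 2 * j"
    and "\<And>R. R \<subseteq> B \<Longrightarrow> clique G R \<Longrightarrow> card R \<le> j"
  shows "\<exists>H' G'. scaffold t \<omega> H' G' \<and> extends H H' \<and> extends G G' \<and>
    (\<forall>\<phi>. fractional_coloring G' \<phi> \<longrightarrow> 2 * real j - S j \<le> measure lebesgue (\<Union>v\<in>B. \<phi> v) \<longrightarrow>
      real t + 1 - S k \<le> measure lebesgue (\<Union>v\<in>pverts G'. \<phi> v))"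
  using \<open>j \<le> k\<close> assms(5-)
\<comment> \<open>\<open>B\<close> is the union of the \<open>j\<close> pairs found so far; the pairing itself is never needed.\<close>
proof (induction j arbitrary: H G B rule: inc_induct)
  case base
  have B: "B \<subseteq> pverts G" "finite B"
    using base.prems(1,2) scaffold_finite_clique[OF base.prems(1,2)] by (auto simp: clique_def scaffold_def)
  have "card R + (\<omega> - k) \<le> \<omega>" if "R \<subseteq> B" "clique G R" for R
    using base.prems(4)[OF that] k by simp
  moreover have "card B + (\<omega> - k) \<le> t + 1" using base t k by simp
  \<comment> \<open>All \<open>k\<close> pairs are present; the
    \<open>\<omega> - k = t + 1 - 2 * k\<close> remaining vertices of the bag form a clique whose
    colors are disjoint from those of \<open>B\<close>.\<close>
  ultimately obtain U H' G' where U: "scaffold t \<omega> H' G'" "extends H H'" "extends G G'" "finite U"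
    "card U = \<omega> - k" "U \<inter> pverts G = {}" "clique G' U" "U \<times> B \<subseteq> parcs G'"
    using scaffold_add_clique[OF base(1,2)] by metis
  interpret G': pair_graph G' using U(1) by (rule scaffold_pair_graph)
  have BU: "U \<subseteq> pverts G'" "B \<subseteq> pverts G'"
    using U(7) B extends_pverts[OF U(3)] by (auto simp: clique_def)
  have *: "real t + 1 - S k \<le> measure lebesgue (\<Union>v\<in>pverts G'. \<phi> v)"
    if \<phi>: "fractional_coloring G' \<phi>" and le: "2 * real k - S k \<le> measure lebesgue (\<Union>v\<in>B. \<phi> v)" for \<phi>
  proof -
    note meas = fractional_coloring_UN_lmeasurable[OF \<phi>]
    have "t + 1 = (\<omega> - k) + 2 * k" using t k by simp
    then have "real t + 1 = real (\<omega> - k) + 2 * real k"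
      by (metis of_nat_1 of_nat_add of_nat_mult of_nat_numeral)
    then have "real t + 1 - S k = real (\<omega> - k) + (2 * real k - S k)" by simp
    also have "\<dots> \<le> measure lebesgue (\<Union>u\<in>U. \<phi> u) + measure lebesgue (\<Union>v\<in>B. \<phi> v)"
      using fractional_coloring_clique[OF \<phi> U(7,4)] U(5) le by simp
    also have "\<dots> = measure lebesgue ((\<Union>u\<in>U. \<phi> u) \<union> (\<Union>v\<in>B. \<phi> v))"
      using meas U(4) B BU fractional_coloring_disjoint[OF \<phi> U(8)]
      by (intro measure_lebesgue_Un_disjoint[symmetric]) auto
    also have "\<dots> \<le> measure lebesgue (\<Union>v\<in>pverts G'. \<phi> v)"
      using meas[OF G'.pair_finite_verts order_refl] meas[OF U(4) BU(1)] meas[OF B(2) BU(2)] BU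
      by (intro measure_mono_fmeasurable) auto
    finally show ?thesis .
  qed
  show ?case
    by (intro exI[of _ H'] exI[of _ G'] conjI allI impI U(1-3) *)
next
  case (step j)
  have B: "B \<subseteq> pverts G" "finite B"
    using step.prems(1,2) scaffold_finite_clique[OF step.prems(1,2)] by (auto simp: clique_def scaffold_def)
  have "card R + (\<omega> - j) \<le> \<omega>" if "R \<subseteq> B" "clique G R" for R
    using step.prems(4)[OF that] step.hyps k by simp
  moreover have "card B + (\<omega> - j) \<le> t + 1" using step t k by simp
  \<comment> \<open>As cliques inside \<open>B\<close> have at most \<open>j\<close> vertices,
    \<open>\<omega> - j\<close> more respect the clique bound. Since \<open>j < k\<close>,
    \<open>B \<union> U\<close> has \<open>\<omega> + j \<le> t\<close> vertices, leaving room for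
    \<open>a\<close> in the bag.\<close>
  ultimately obtain U H1 G1 where U: "scaffold t \<omega> H1 G1" "extends H H1" "extends G G1" "finite U"
    "card U = \<omega> - j" "U \<inter> pverts G = {}" "clique G1 U" "U \<times> B \<subseteq> parcs G1" "clique H1 (B \<union> U)"
    using scaffold_add_clique[OF step.prems(1,2)] by metis
  have cB: "card R \<le> j" if "R \<subseteq> B" "clique G' R" "extends G G'" for R G'
    using clique_extendsD[OF that(3,2)] that(1) step.prems(4) B by blast
  have "card R < \<omega>" if "R \<subseteq> B" "clique G1 R" for R
    using cB[OF that U(3)] step.hyps k by simp
  moreover have "card (B \<union> U) \<le> t"
    using card_Un_le[of B U] step t k U(5) by simp
  \<comment> \<open>In the graph \<open>a\<close> is joined to \<open>B\<close> only, in the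
    \<open>t\<close>-tree also to \<open>U\<close>; thus \<open>B \<union> {a, u}\<close> is a
    clique of the \<open>t\<close>-tree for every \<open>u\<close> in \<open>U\<close>.\<close>
  ultimately obtain a H2 G2 where a: "scaffold t \<omega> H2 G2" "extends H1 H2" "extends G1 G2"
    "a \<notin> pverts G1" "clique H2 (insert a (B \<union> U))" "\<And>w. (a, w) \<in> parcs G2 \<longleftrightarrow> w \<in> B"
    "a \<in> pverts G2"
    using scaffold_add_vertex[OF U(1,9) _ Un_upper1] by metis
  interpret G2: pair_graph G2 using a(1) by (rule scaffold_pair_graph)
  have aU: "a \<notin> U" "a \<notin> B" "U \<inter> B = {}" "U \<noteq> {}" "U \<subseteq> pverts G2"
    using U B a(4) extends_pverts[OF U(3)] extends_pverts[OF a(3)] step.hyps k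
    by (auto simp: clique_def)
  have G02: "extends G G2" "extends H H2" using U a extends_trans by blast+
  let ?B = "\<lambda>u. B \<union> {a, u}"
  \<comment> \<open>The conclusion of the induction hypothesis for the new pair
    \<open>{a, u}\<close>. One graph will satisfy it for all \<open>u\<close>, so that
    \<open>u\<close> may later depend on \<open>\<phi>\<close>.\<close>
  let ?Q = "\<lambda>u G'. \<forall>\<phi>. fractional_coloring G' \<phi> \<longrightarrow>
    2 * real (Suc j) - S (Suc j) \<le> measure lebesgue (\<Union>v\<in>?B u. \<phi> v) \<longrightarrow>
    real t + 1 - S k \<le> measure lebesgue (\<Union>v\<in>pverts G'. \<phi> v)"
  have "\<exists>H' G'. scaffold t \<omega> H' G' \<and> extends H2 H' \<and> extends G2 G' \<and> (\<forall>u\<in>U. ?Q u G')"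
  proof (rule scaffold_extend_all[OF U(4) a(1)])
    fix u H' G'
    assume u: "u \<in> U" and s': "scaffold t \<omega> H' G'" and e': "extends H2 H'" "extends G2 G'"
    have "clique H' (?B u)"
      using u by (intro clique_subset[OF clique_extends[OF e'(1) a(5)]]) auto
    moreover have "u \<noteq> a" "u \<notin> B" using u aU by auto
    then have "card (?B u) = 2 * Suc j"
      using aU(2) B(2) step.prems(3) by simp
    moreover have "card R \<le> Suc j" if R: "R \<subseteq> ?B u" "clique G' R" for R
    proof -
      have "?B u \<subseteq> pverts G2"
        using u aU a(7) B extends_pverts[OF G02(1)] by auto
      then have "clique G2 R" using R by (intro clique_extendsD[OF e'(2)]) auto
      \<comment> \<open>\<open>a\<close> and \<open>u\<close> are nonadjacent, so a clique gains at
        most one vertex from the pair.\<close>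
      then have "\<not> {a, u} \<subseteq> R" using a(6)[of u] u aU by (auto simp: clique_def)
      then obtain x where "R \<subseteq> insert x (R \<inter> B)" using R(1) by blast
      then have "card R \<le> card (insert x (R \<inter> B))" using B by (intro card_mono) auto
      also have "\<dots> \<le> Suc (card (R \<inter> B))" using B by (simp add: card_insert_if)
      also have "card (R \<inter> B) \<le> j"
        using R G02 e' by (intro cB[of _ G']) (auto intro: clique_subset extends_trans)
      finally show ?thesis by simp
    qed
    ultimately show "\<exists>H'' G''. scaffold t \<omega> H'' G'' \<and> extends H' H'' \<and> extends G' G'' \<and> ?Q u G''"
      using step.IH[OF s'] by blast
  next
    fix u and G' G'' :: "'a pair_pre_digraph"
    assume Q: "?Q u G'" and e: "extends G' G''" and "pair_graph G''"
    interpret G'': pair_graph G'' by fact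
    show "?Q u G''"
    proof (intro allI impI)
      fix \<phi>
      assume \<phi>: "fractional_coloring G'' \<phi>"
        and le: "2 * real (Suc j) - S (Suc j) \<le> measure lebesgue (\<Union>v\<in>?B u. \<phi> v)"
      \<comment> \<open>The premise on \<open>?B u\<close> mentions only \<open>\<phi>\<close>, not
        the graph; the conclusion persists because the union over more vertices is at least as
        large.\<close>
      have "finite (pverts G')" using extends_pverts[OF e] G''.pair_finite_verts finite_subset by blast
      then have "measure lebesgue (\<Union>v\<in>pverts G'. \<phi> v) \<le> measure lebesgue (\<Union>v\<in>pverts G''. \<phi> v)"
        using fractional_coloring_UN_lmeasurable[OF \<phi>] extends_pverts[OF e] G''.pair_finite_verts
        by (intro measure_mono_fmeasurable) auto
      with Q le fractional_coloring_extends[OF e \<phi>]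
      show "real t + 1 - S k \<le> measure lebesgue (\<Union>v\<in>pverts G''. \<phi> v)" by force
    qed
  qed
  then obtain H3 G3 where 3: "scaffold t \<omega> H3 G3" "extends H2 H3" "extends G2 G3" "\<forall>u\<in>U. ?Q u G3"
    by blast
  have *: "real t + 1 - S k \<le> measure lebesgue (\<Union>v\<in>pverts G3. \<phi> v)"
    if \<phi>3: "fractional_coloring G3 \<phi>" and le: "2 * real j - S j \<le> measure lebesgue (\<Union>v\<in>B. \<phi> v)" for \<phi>
  proof -
    have \<phi>: "fractional_coloring G2 \<phi>" using fractional_coloring_extends[OF 3(3) \<phi>3] .
    note meas = fractional_coloring_lmeasurable[OF \<phi>]
    have "clique G2 U" using clique_extends[OF a(3) U(7)] .
    then obtain u where u: "u \<in> U" "measure lebesgue (\<phi> a \<inter> \<phi> u) \<le> 1 / card U"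
      using fractional_coloring_small_overlap[OF \<phi> _ U(4) aU(4) a(7)] by blast
    have au: "\<phi> a \<in> lmeasurable" "\<phi> u \<in> lmeasurable" "measure lebesgue (\<phi> a) = 1" "measure lebesgue (\<phi> u) = 1"
      using meas a(7) u aU(5) by auto
    have "{a, u} \<times> B \<subseteq> parcs G2"
      using a(6) U(8) extends_parcs[OF a(3)] u by auto
    from fractional_coloring_disjoint[OF \<phi> this]
    have dis: "(\<phi> a \<union> \<phi> u) \<inter> (\<Union>v\<in>B. \<phi> v) = {}" by simp
    \<comment> \<open>The summand at \<open>i = Suc j\<close> is
      \<open>1 / (\<omega> - (j + 1) + 1) = 1 / (\<omega> - j)\<close>, the overlap bound for this
      pair.\<close>
    have "S (Suc j) = S j + 1 / card U"
      using U(5) step.hyps k by (simp add: S_def of_nat_diff)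
    then have "2 * real (Suc j) - S (Suc j) = (1 + 1 - 1 / card U) + (2 * real j - S j)" by simp
    \<comment> \<open>Inclusion-exclusion for the two color sets of measure 1.\<close>
    also have "\<dots> \<le> measure lebesgue (\<phi> a \<union> \<phi> u) + measure lebesgue (\<Union>v\<in>B. \<phi> v)"
      using u(2) le au measure_Un3[OF au(1,2)] by simp
    also have "\<dots> = measure lebesgue ((\<phi> a \<union> \<phi> u) \<union> (\<Union>v\<in>B. \<phi> v))"
      using au dis B extends_pverts[OF G02(1)] fractional_coloring_UN_lmeasurable[OF \<phi> B(2)]
      by (intro measure_lebesgue_Un_disjoint[symmetric]) auto
    also have "(\<phi> a \<union> \<phi> u) \<union> (\<Union>v\<in>B. \<phi> v) = (\<Union>v\<in>?B u. \<phi> v)" by auto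
    finally show ?thesis using 3(4) u(1) \<phi>3 by blast
  qed
  show ?case
    by (intro exI[of _ H3] exI[of _ G3] conjI allI impI 3(1) * extends_trans[OF G02(1) 3(3)]
        extends_trans[OF G02(2) 3(2)])
qed

section \<open>A starting graph of minimum degree \<open>t\<close>\<close>

text \<open>
  Starting from \<open>K\<^bsub>t,t\<^esub>\<close>, whose minimum degree is \<open>t\<close>, keeps the treewidth from being smaller than
  \<open>t\<close>: the forced bag alone does not, because its nonadjacent pairs lower its treewidth.
\<close>

lemma scaffold_bipartite_start:
  fixes t \<omega> :: nat
  assumes "\<omega> \<ge> 2" "t \<ge> 1"
  obtains H G :: "nat pair_pre_digraph" and W where "scaffold t \<omega> H G" "W \<subseteq> pverts G" "W \<noteq> {}"
    "\<And>w. w \<in> W \<Longrightarrow> t \<le> card {x\<in>W. (w, x) \<in> parcs G}"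
proof -
  let ?T = "{..<t}"
  \<comment> \<open>\<open>?T\<close> is a \<open>t\<close>-clique of the \<open>t\<close>-tree but
    independent in the graph, so any number of vertices can be attached to all of \<open>?T\<close>;
    a clique inside \<open>?T\<close> has at most one vertex, which is below
    \<open>\<omega>\<close>.\<close>
  have "\<exists>H G :: nat pair_pre_digraph. \<exists>Y. scaffold t \<omega> H G \<and> clique H ?T \<and> ?T \<inter> Y = {} \<and> ?T \<union> Y \<subseteq> pverts G \<and>
    finite Y \<and> card Y = n \<and> Y \<times> ?T \<subseteq> parcs G \<and> (\<forall>u\<in>?T. \<forall>v\<in>?T. (u, v) \<notin> parcs G)" for n
  proof (induction n)
    case 0
    let ?H = "\<lparr>pverts = ?T, parcs = {(u, v). (u, v) \<in> ?T \<times> ?T \<and> u \<noteq> v}\<rparr>"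
    let ?G = "\<lparr>pverts = ?T, parcs = {}\<rparr>"
    have "complete_digraph t (with_proj ?H)"
      unfolding complete_digraph_pair_def by simp
    then have "t_tree t ?H" by (rule t_tree.base)
    moreover have "pair_graph ?G"
      by unfold_locales (auto simp: symmetric_def sym_def)
    moreover have "card S \<le> \<omega>" if "clique ?G S" for S
    proof -
      have "\<forall>x\<in>S. \<forall>y\<in>S. x = y" using that by (auto simp: clique_def)
      then show ?thesis
        using assms card_le_Suc0_iff_eq[of S] by (cases "finite S") auto
    qed
    ultimately show ?case
      by (intro exI[of _ ?H] exI[of _ ?G] exI[of _ "{}"]) (auto simp: scaffold_def clique_def)
  next
    case (Suc n)
    then obtain H G :: "nat pair_pre_digraph" and Y where IH: "scaffold t \<omega> H G" "clique H ?T"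
      "?T \<inter> Y = {}" "?T \<union> Y \<subseteq> pverts G" "finite Y" "card Y = n" "Y \<times> ?T \<subseteq> parcs G"
      "\<forall>u\<in>?T. \<forall>v\<in>?T. (u, v) \<notin> parcs G" by blast
    have "card S < \<omega>" if "S \<subseteq> ?T" "clique G S" for S
    proof -
      have "\<forall>x\<in>S. \<forall>y\<in>S. x = y"
        using that IH(8) unfolding clique_def by (metis subsetD)
      then show ?thesis
        using assms card_le_Suc0_iff_eq[of S] by (cases "finite S") auto
    qed
    then obtain v H' G' where v: "scaffold t \<omega> H' G'" "extends H H'" "extends G G'" "v \<notin> pverts G"
      "\<And>w. (v, w) \<in> parcs G' \<longleftrightarrow> w \<in> ?T" "v \<in> pverts G'"
      using scaffold_add_vertex[OF IH(1,2) _ order_refl] by (metis card_lessThan order_refl)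
    have "\<forall>u\<in>?T. \<forall>v\<in>?T. (u, v) \<notin> parcs G'"
      using IH(4,8) v(3) unfolding extends_def by blast
    moreover have "insert v Y \<times> ?T \<subseteq> parcs G'"
      using IH(7) v(5) extends_parcs[OF v(3)] by auto
    moreover have "?T \<union> insert v Y \<subseteq> pverts G'"
      using IH(4) v(6) extends_pverts[OF v(3)] by auto
    moreover have "?T \<inter> insert v Y = {}" "v \<notin> Y" using IH(3,4) v(4) by auto
    ultimately show ?case
      using v IH clique_extends[OF v(2) IH(2)]
      by (intro exI[of _ H'] exI[of _ G'] exI[of _ "insert v Y"]) simp
  qed
  from this[of t] obtain H G :: "nat pair_pre_digraph" and Y where Y: "scaffold t \<omega> H G"
    "?T \<union> Y \<subseteq> pverts G" "finite Y" "card Y = t" "Y \<times> ?T \<subseteq> parcs G" by blast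
  interpret pair_graph G using Y(1) by (rule scaffold_pair_graph)
  have "t \<le> card {x \<in> ?T \<union> Y. (w, x) \<in> parcs G}" if w: "w \<in> ?T \<union> Y" for w
  proof -
    have fin: "finite {x \<in> ?T \<union> Y. (w, x) \<in> parcs G}" using Y by simp
    consider "w \<in> ?T" | "w \<in> Y" using w by blast
    then show ?thesis
    proof cases
      case 1
      then have "Y \<subseteq> {x \<in> ?T \<union> Y. (w, x) \<in> parcs G}"
        using Y(5) by (auto intro: arcs_symmetric)
      from card_mono[OF fin this] show ?thesis using Y(4) by simp
    next
      case 2
      then have "?T \<subseteq> {x \<in> ?T \<union> Y. (w, x) \<in> parcs G}"
        using Y(5) by auto
      from card_mono[OF fin this] show ?thesis by simp
    qed
  qed
  moreover have "?T \<union> Y \<noteq> {}" using Y(4) assms(2) by force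
  ultimately show ?thesis using that[OF Y(1,2)] by blast
qed

section \<open>Treewidth, clique number and fractional chromatic number of the resulting
  graph\<close>

theorem corollary4p4:
  fixes t \<omega> :: nat
  assumes "t \<ge> 1" and "\<omega> \<ge> 2"
    and "real (t + 1) / 2 \<le> real \<omega>" and "\<omega> \<le> t"
  shows "\<exists>G :: nat pair_pre_digraph. pair_graph G \<and> treewidth G = t \<and> clique_number G = \<omega> \<and>
    fractional_chromatic_number G
      \<ge> real t + 1 - (\<Sum>i = 1..t - \<omega> + 1. 1 / (real \<omega> - real i + 1))"
proof -
  \<comment> \<open>The number of nonadjacent pairs. The assumption that \<open>\<omega>\<close> is
    at least half of \<open>t + 1\<close> says exactly that \<open>k \<le> \<omega>\<close>.\<close>
  define k where "k = t - \<omega> + 1"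
  have k: "t + 1 = \<omega> + k" "k \<le> \<omega>" using assms(3,4) by (auto simp: k_def)
  obtain H0 G0 :: "nat pair_pre_digraph" and W where 0: "scaffold t \<omega> H0 G0" "W \<subseteq> pverts G0" "W \<noteq> {}"
    "\<And>w. w \<in> W \<Longrightarrow> t \<le> card {x\<in>W. (w, x) \<in> parcs G0}"
    using scaffold_bipartite_start assms by blast
  have empty: "clique G' {}" for G' :: "nat pair_pre_digraph" by (simp add: clique_def)
  \<comment> \<open>A clique of size \<open>\<omega>\<close> built over the empty set makes the
    scaffold's clique bound sharp.\<close>
  have "card {} + \<omega> \<le> t + 1" and "\<And>S. S \<subseteq> {} \<Longrightarrow> clique G0 S \<Longrightarrow> card S + \<omega> \<le> \<omega>"
    using assms(4) by auto
  from scaffold_add_clique[OF 0(1) empty this]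
  obtain U H1 G1 where 1: "scaffold t \<omega> H1 G1" "extends G0 G1" "card U = \<omega>" "clique G1 U"
    by metis
  \<comment> \<open>With \<open>j = 0\<close> and \<open>B\<close> empty the premise on
    \<open>\<phi>\<close> reads \<open>0 \<le> 0\<close>, so the bound holds for every
    coloring.\<close>
  obtain H G where 2: "scaffold t \<omega> H G" "extends G1 G" and
    *: "\<And>\<phi>. fractional_coloring G \<phi> \<Longrightarrow>
      real t + 1 - (\<Sum>i = 1..k. 1 / (real \<omega> - real i + 1)) \<le> measure lebesgue (\<Union>v\<in>pverts G. \<phi> v)"
    using scaffold_forces_colors[OF k, of 0 H1 G1 "{}"] 1 empty by auto
  interpret pair_graph G using 2(1) by (rule scaffold_pair_graph)
  have "treewidth G = t"
    unfolding treewidth_def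
  proof (rule Least_equality)
    show "partial_t_tree t G" using 2(1) by (rule scaffold_partial_t_tree)
  next
    fix s assume s: "partial_t_tree s G"
    have e: "extends G0 G" using 1 2 extends_trans by blast
    have "t \<le> card {x\<in>W. (w, x) \<in> parcs G}" if "w \<in> W" for w
    proof -
      \<comment> \<open>The extension is induced, so the degrees inside \<open>W\<close> are still
        those of the bipartite start.\<close>
      have "{x\<in>W. (w, x) \<in> parcs G} = {x\<in>W. (w, x) \<in> parcs G0}"
        using e that 0(2) unfolding extends_def by blast
      then show ?thesis using 0(4)[OF that] by simp
    qed
    then show "t \<le> s"
      using partial_t_tree_min_degree[OF s] 0(2,3) extends_pverts[OF e] by blast
  qed
  moreover have "clique_number G = \<omega>"
    unfolding clique_number_def
  proof (rule Max_eqI)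
    show "finite {card S |S. clique G S}" using pair_graph by (rule finite_clique_cards)
    show "y \<le> \<omega>" if "y \<in> {card S |S. clique G S}" for y
      using that 2(1) by (auto simp: scaffold_def)
    show "\<omega> \<in> {card S |S. clique G S}"
      using clique_extends[OF 2(2) 1(4)] 1(3) by blast
  qed
  moreover have "real t + 1 - (\<Sum>i = 1..k. 1 / (real \<omega> - real i + 1)) \<le> fractional_chromatic_number G"
    unfolding fractional_chromatic_number_def
    using fractional_coloring_exists[OF pair_graph] * by (intro cInf_greatest) auto
  ultimately show ?thesis using pair_graph unfolding k_def by blast
qed

end
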